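(* Let $\varepsilon\in[0,1]$ and let $\mathbf p,\mathbf q\in\mathrm{Prob}(d)$ with $q_x>0$ for all $x\in[d]$. Put $r_x:=p_x/q_x$, $$a:=\inf\Big\{\lambda>0:\sum_{x\in[d]}\max\{p_x-\lambda q_x,0\}\le\varepsilon\Big\},\qquad b:=\sup\Big\{\lambda>0:\sum_{x\in[d]}\max\{\lambda q_x-p_x,0\}\le\varepsilon\Big\},$$ and define the vector $\mathbf p^{(\varepsilon)}\in\mathbb R_+^d$ by $$p_x^{(\varepsilon)}:=q_x\max\big\{b,\min\{a,r_x\}\big\},\qquad x\in[d].$$ Then $\mathbf p^{(\varepsilon)}$ is the flattest $\varepsilon$-approximation of $\mathbf p$ relative to $\mathbf q$, i.e. $\mathbf p^{(\varepsilon)}\in\mathfrak B^\varepsilon(\mathbf p)$ and $$(\mathbf p',\mathbf q)\succ(\mathbf p^{(\varepsilon)},\mathbf q)\qquad\text{for all }\mathbf p'\in\mathfrak B^\varepsilon(\mathbf p).$$ Consequently, every classical divergence $\mathbf D$ satisfies $$\mathbf D^\varepsilon(\mathbf p\|\mathbf q)=\mathbf D\big(\mathbf p^{(\varepsilon)}\big\|\mathbf q\big).$$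
   Context: $[d]=\{1,\dots,d\}$; $\mathrm{Prob}(d)$ is the set of $d$-dimensional probability vectors. $\mathfrak B^\varepsilon(\mathbf p)=\{\mathbf p'\in\mathrm{Prob}(d):\frac12\|\mathbf p-\mathbf p'\|_1\le\varepsilon\}$. When the components are ordered so that $r_1\ge r_2\ge\cdots\ge r_d$, the clipping thresholds have the closed forms $a=\max_{m\in[d]}\frac{\sum_{x=1}^m p_x-\varepsilon}{\sum_{x=1}^m q_x}$ and $b=\min_{\ell\in[d]}\frac{\sum_{x=\ell}^d p_x+\varepsilon}{\sum_{x=\ell}^d q_x}$. Relative majorization: for $\mathbf p,\mathbf q\in\mathrm{Prob}(d)$ and $\mathbf p',\mathbf q'\in\mathrm{Prob}(d')$, $(\mathbf p,\mathbf q)\succ(\mathbf p',\mathbf q')$ means that there is a $d'\times d$ column-stochastic matrix $E$ with $E\mathbf p=\mathbf p'$ and $E\mathbf q=\mathbf q'$. A classical divergence is a function $\mathbf D$ on pairs of probability vectors of equal (arbitrary finite) dimension, with values in $\mathbb R\cup\{\infty\}$, satisfying $\mathbf D(E\mathbf p\|E\mathbf q)\le\mathbf D(\mathbf p\|\mathbf q)$ for every column-stochastic matrix $E$. Its $\varepsilon$-smoothed version is $\mathbf D^\varepsilon(\mathbf p\|\mathbf q)=\min_{\mathbf p'\in\mathfrak B^\varepsilon(\mathbf p)}\mathbf D(\mathbf p'\|\mathbf q)$.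
   Formalization: The claim for p^(ε) is proved for ε ≤ ½‖p−q‖₁ only; for larger ε it is false (d=1, p=q=(1), ε=½ gives p^(ε)=(3/2), mass > 1), and there q is shown to be the flattest approximation, with D^ε(p‖q)=D(q‖q). The supremum b of an empty set is read as 0. *)

theory Defs
  imports "Jordan_Normal_Form.Matrix" "HOL-Library.Extended_Real"
begin

definition Prob :: "nat \<Rightarrow> real vec set" where
  "Prob d = {p \<in> carrier_vec d. (\<forall>x<d. 0 \<le> p $ x) \<and> (\<Sum>x<d. p $ x) = 1}"

definition l1_norm :: "real vec \<Rightarrow> real" where
  "l1_norm v = (\<Sum>x<dim_vec v. \<bar>v $ x\<bar>)"

definition prob_ball :: "real \<Rightarrow> real vec \<Rightarrow> real vec set" where
  "prob_ball \<epsilon> p = {p' \<in> Prob (dim_vec p). 1/2 * l1_norm (p - p') \<le> \<epsilon>}"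

definition column_stochastic :: "real mat \<Rightarrow> bool" where
  "column_stochastic E \<longleftrightarrow>
     (\<forall>i<dim_row E. \<forall>j<dim_col E. 0 \<le> E $$ (i, j)) \<and>
     (\<forall>j<dim_col E. (\<Sum>i<dim_row E. E $$ (i, j)) = 1)"

text \<open>Relative majorization \<open>(p, q) \<succ> (p', q')\<close>; meant for pairs of probability vectors of
  equal dimension, which may differ between the two pairs.\<close>

definition rel_majorizes :: "real vec \<times> real vec \<Rightarrow> real vec \<times> real vec \<Rightarrow> bool"
    (infix "\<succ>" 50) where
  "pq \<succ> pq' \<longleftrightarrow>
     (\<exists>E \<in> carrier_mat (dim_vec (fst pq')) (dim_vec (fst pq)).
        column_stochastic E \<and> E *\<^sub>v fst pq = fst pq' \<and> E *\<^sub>v snd pq = snd pq')"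

text \<open>Only the values on pairs of probability vectors of equal dimension matter; there they
  lie in \<open>\<real> \<union> {\<infinity>}\<close>.\<close>

definition classical_divergence :: "(real vec \<Rightarrow> real vec \<Rightarrow> ereal) \<Rightarrow> bool" where
  "classical_divergence D \<longleftrightarrow>
     (\<forall>d. \<forall>p \<in> Prob d. \<forall>q \<in> Prob d. D p q \<noteq> -\<infinity>) \<and>
     (\<forall>d d'. \<forall>p \<in> Prob d. \<forall>q \<in> Prob d. \<forall>E \<in> carrier_mat d' d.
        column_stochastic E \<longrightarrow> D (E *\<^sub>v p) (E *\<^sub>v q) \<le> D p q)"

text \<open>The smoothed divergence is a minimum over the ball. It is rendered as an infimum, so that
  it is defined for every \<open>D\<close>; an equation \<open>smoothed_divergence D \<epsilon> p q = D p' q\<close> with \<open>p'\<close> in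
  the ball says that the minimum exists and is attained at \<open>p'\<close>.\<close>

definition smoothed_divergence ::
    "(real vec \<Rightarrow> real vec \<Rightarrow> ereal) \<Rightarrow> real \<Rightarrow> real vec \<Rightarrow> real vec \<Rightarrow> ereal" where
  "smoothed_divergence D \<epsilon> p q = (INF p' \<in> prob_ball \<epsilon> p. D p' q)"

definition flattest_approx :: "real \<Rightarrow> real vec \<Rightarrow> real vec \<Rightarrow> real vec \<Rightarrow> bool" where
  "flattest_approx \<epsilon> p q v \<longleftrightarrow>
     v \<in> prob_ball \<epsilon> p \<and> (\<forall>p' \<in> prob_ball \<epsilon> p. (p', q) \<succ> (v, q))"

definition upper_threshold :: "real \<Rightarrow> real vec \<Rightarrow> real vec \<Rightarrow> real" where
  "upper_threshold \<epsilon> p q =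
     Inf {t. t > 0 \<and> (\<Sum>x<dim_vec p. max (p $ x - t * q $ x) 0) \<le> \<epsilon>}"

text \<open>If \<open>\<epsilon> = 0\<close> and some \<open>p $ x\<close> is zero, no \<open>t > 0\<close> qualifies. The supremum is then \<open>0\<close>, as
  usual for sets of nonnegative numbers and in agreement with
  \<open>min\<^sub>l (\<Sum>x\<ge>l. p $ x + \<epsilon>) / (\<Sum>x\<ge>l. q $ x)\<close> (components ordered by decreasing
  \<open>p $ x / q $ x\<close>), whereas \<open>Sup {}\<close> is unspecified on the reals; hence the inserted \<open>0\<close>.\<close>

definition lower_threshold :: "real \<Rightarrow> real vec \<Rightarrow> real vec \<Rightarrow> real" where
  "lower_threshold \<epsilon> p q =
     Sup (insert 0 {t. t > 0 \<and> (\<Sum>x<dim_vec p. max (t * q $ x - p $ x) 0) \<le> \<epsilon>})"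

definition clipped_vec :: "real \<Rightarrow> real vec \<Rightarrow> real vec \<Rightarrow> real vec" where
  "clipped_vec \<epsilon> p q =
     vec (dim_vec p) (\<lambda>x. q $ x *
       max (lower_threshold \<epsilon> p q) (min (upper_threshold \<epsilon> p q) (p $ x / q $ x)))"

text \<open>Clipping yields the flattest approximation exactly as long as \<open>\<epsilon>\<close> does not exceed the
  total variation distance of \<open>p\<close> and \<open>q\<close>. Beyond it, the thresholds cross and
  \<open>clipped_vec \<epsilon> p q\<close> has total mass greater than one, so the ball, which then contains \<open>q\<close>,
  does not contain it. For instance \<open>p = q\<close> and \<open>0 < \<epsilon>\<close> give \<open>(1 + \<epsilon>) q\<close>.\<close>

lemma clipped_vec_not_Prob:
  assumes p: "p \<in> Prob d" and q: "q \<in> Prob d"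
    and far: "1/2 * l1_norm (p - q) < \<epsilon>"
  shows "clipped_vec \<epsilon> p q \<notin> Prob d"
proof -
  have dims: "dim_vec p = d" "dim_vec q = d"
    and q0: "\<And>x. x < d \<Longrightarrow> 0 \<le> q $ x"
    and p1: "(\<Sum>x<d. p $ x) = 1" and q1: "(\<Sum>x<d. q $ x) = 1"
    using p q by (auto simp: Prob_def)
  let ?t = "1/2 * l1_norm (p - q)"
  let ?S = "\<lambda>l. \<Sum>x<d. max (l * q $ x - p $ x) 0"
  let ?A = "insert 0 {l. l > 0 \<and> ?S l \<le> \<epsilon>}"
  define l where "l = 1 + (\<epsilon> - ?t)"
  have l1: "l > 1" using far by (simp add: l_def)
  have "?S l \<le> (\<Sum>x<d. (l - 1) * q $ x + (\<bar>p $ x - q $ x\<bar> + (q $ x - p $ x)) / 2)"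
  proof (rule sum_mono)
    fix x assume "x \<in> {..<d}"
    then have "0 \<le> (l - 1) * q $ x" using q0 l1 by simp
    then show "max (l * q $ x - p $ x) 0
        \<le> (l - 1) * q $ x + (\<bar>p $ x - q $ x\<bar> + (q $ x - p $ x)) / 2"
      by (simp add: left_diff_distrib max_def abs_if field_simps)
  qed
  also have "\<dots> = (l - 1) * (\<Sum>x<d. q $ x)
      + ((\<Sum>x<d. \<bar>p $ x - q $ x\<bar>) + ((\<Sum>x<d. q $ x) - (\<Sum>x<d. p $ x))) / 2"
    by (simp add: sum.distrib sum_subtractf sum_distrib_left sum_divide_distrib [symmetric])
  also have "\<dots> = \<epsilon>"
    using p1 q1 by (simp add: l_def l1_norm_def dims)
  finally have mem: "l \<in> ?A" using l1 by simp
  have bdd: "bdd_above ?A"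
  proof (rule bdd_aboveI [of _ "1 + \<epsilon>"])
    fix m assume m: "m \<in> ?A"
    have "m - 1 = (\<Sum>x<d. m * q $ x - p $ x)"
      by (simp add: sum_subtractf sum_distrib_left [symmetric] p1 q1)
    also have "\<dots> \<le> ?S m" by (intro sum_mono) simp
    finally have "m - 1 \<le> ?S m" .
    moreover have "0 \<le> \<epsilon>" using far by (simp add: l1_norm_def) (smt (verit) sum_nonneg)
    ultimately show "m \<le> 1 + \<epsilon>" using m by auto
  qed
  let ?b = "lower_threshold \<epsilon> p q"
  have b: "?b > 1"
    using cSup_upper [OF mem bdd] l1 by (simp add: lower_threshold_def dims)
  have "1 < ?b * (\<Sum>x<d. q $ x)" using b q1 by simp
  also have "\<dots> = (\<Sum>x<d. q $ x * ?b)" by (simp add: sum_distrib_left mult.commute)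
  also have "\<dots> \<le> (\<Sum>x<d. clipped_vec \<epsilon> p q $ x)"
    by (intro sum_mono) (auto simp: clipped_vec_def dims intro!: mult_left_mono q0)
  finally show ?thesis by (auto simp: Prob_def)
qed

end

theory Submission
  imports Defs "HOL-Analysis.Function_Topology" "HOL-Analysis.Elementary_Metric_Spaces"
begin

text \<open>
  The pairs \<open>(E p', E q)\<close>, \<open>E\<close> column stochastic, form a compact convex set. If it missed
  \<open>(v, q)\<close>, the nearest point would give a separating functional \<open>(h, k)\<close>. Maximised over \<open>E\<close>,
  that functional equals \<open>\<Sum>q\<^sub>x \<phi> (p'\<^sub>x / q\<^sub>x)\<close> with the convex function
  \<open>\<phi> r = max\<^sub>i (h\<^sub>i r + k\<^sub>i)\<close>, while its value at \<open>(v, q)\<close> is at most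
  \<open>\<Sum>q\<^sub>x \<phi> (v\<^sub>x / q\<^sub>x)\<close>. So it suffices to show that the clipped vector \<open>v\<close> minimises the
  convex functional over the ball. Let \<open>g\<^sub>x\<close> be a subgradient of \<open>\<phi>\<close> at \<open>v\<^sub>x / q\<^sub>x\<close>, which lies
  in \<open>[b, a]\<close>. Clipping removes mass \<open>\<epsilon>\<close> where \<open>g\<close> is largest and adds it where \<open>g\<close> is smallest,
  so among all points of the ball \<open>v\<close> minimises the linear functional \<open>\<Sum>g\<^sub>x p'\<^sub>x\<close>.
\<close>

section \<open>Separation from the compact convex set of attainable pairs\<close>

text \<open>First-order condition along a segment leaving a minimiser: for small \<open>t\<close>
  the quadratic term cannot outweigh a positive linear one.\<close>

lemma nonpos_if_le_quadratic:
  fixes L Q :: real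
  assumes "\<And>t. 0 < t \<Longrightarrow> t \<le> 1 \<Longrightarrow> 2 * (t * L) \<le> t\<^sup>2 * Q"
  shows "L \<le> 0"
proof (rule ccontr)
  assume "\<not> L \<le> 0"
  then have L: "L > 0" by simp
  \<comment> \<open>Chosen so that \<open>t * (L + \<bar>Q\<bar>) = L\<close>, which bounds
    \<open>t * Q\<close> by \<open>L\<close>, half of what the assumption demands.\<close>
  define t where "t = L / (L + \<bar>Q\<bar>)"
  have t: "0 < t" "t \<le> 1" using L by (auto simp: t_def)
  have "t * (2 * L) \<le> t * (t * Q)"
    using assms[OF t] by (simp add: power2_eq_square algebra_simps)
  then have "2 * L \<le> t * Q" using t by simp
  also have "t * Q \<le> t * (L + \<bar>Q\<bar>)" using t L by (intro mult_left_mono) auto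
  also have "\<dots> = L" using L by (simp add: t_def)
  finally show False using L by simp
qed

text \<open>\<open>dual\<close> is applied to the residual \<open>(h, k)\<close> at a nearest
  attainable pair. Optimality makes its inner product with every direction towards an attainable
  pair nonpositive, while \<open>dual\<close> supplies a direction whose product is at least the
  squared residual. Hence the residual vanishes.\<close>

lemma stochastic_solution:
  fixes p q v w :: "nat \<Rightarrow> real"
  assumes dual: "\<And>h k. \<exists>e. (\<forall>x. 0 \<le> e x \<and> e x \<le> 1) \<and> (\<forall>j<n. (\<Sum>i<m. e (i, j)) = 1) \<and>
      (\<Sum>i<m. h i * v i + k i * w i)
        \<le> (\<Sum>i<m. h i * (\<Sum>j<n. e (i, j) * p j) + k i * (\<Sum>j<n. e (i, j) * q j))"
  shows "\<exists>e. (\<forall>x. 0 \<le> e x \<and> e x \<le> 1) \<and> (\<forall>j<n. (\<Sum>i<m. e (i, j)) = 1) \<and>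
      (\<forall>i<m. (\<Sum>j<n. e (i, j) * p j) = v i \<and> (\<Sum>j<n. e (i, j) * q j) = w i)"
proof -
  define A where "A e i = (\<Sum>j<n. e (i, j) * p j)" for e :: "nat \<times> nat \<Rightarrow> real" and i
  define B where "B e i = (\<Sum>j<n. e (i, j) * q j)" for e :: "nat \<times> nat \<Rightarrow> real" and i
  define F where "F e = (\<Sum>i<m. (v i - A e i)\<^sup>2 + (w i - B e i)\<^sup>2)" for e
  \<comment> \<open>Bounding every coordinate, also those outside the \<open>m\<close> by
    \<open>n\<close> block, puts \<open>C\<close> inside a full cube, compact by Tychonoff's
    theorem; the column sums cut out a closed subset.\<close>
  define C where "C = (\<Pi>\<^sub>E x\<in>UNIV. {0..1::real}) \<inter>
      (\<Inter>j\<in>{..<n}. {e :: nat \<times> nat \<Rightarrow> real. (\<Sum>i<m. e (i, j)) = 1})"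
  have C_iff: "e \<in> C \<longleftrightarrow> (\<forall>x. 0 \<le> e x \<and> e x \<le> 1) \<and> (\<forall>j<n. (\<Sum>i<m. e (i, j)) = 1)" for e
    by (auto simp: C_def PiE_iff)
  have coord: "continuous_on UNIV (\<lambda>e :: nat \<times> nat \<Rightarrow> real. e x)" for x
    by (rule continuous_on_product_coordinates)
  have "compact (\<Pi>\<^sub>E x\<in>(UNIV :: (nat \<times> nat) set). {0..1::real})"
    unfolding compactin_euclidean_iff[symmetric] euclidean_product_topology[symmetric]
      compactin_PiE by auto
  moreover have "closed {e :: nat \<times> nat \<Rightarrow> real. (\<Sum>i<m. e (i, j)) = 1}" for j
    by (intro closed_Collect_eq continuous_intros coord)
  ultimately have compact: "compact C"
    unfolding C_def by (intro compact_Int_closed closed_INT) auto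
  have ne: "C \<noteq> {}" using dual[of "\<lambda>_. 0" "\<lambda>_. 0"] C_iff by blast
  have cont: "continuous_on C F"
    unfolding F_def A_def B_def
    by (rule continuous_on_subset[of UNIV]) (auto intro!: continuous_intros coord)
  from continuous_attains_inf[OF compact ne cont]
  obtain e0 where e0: "e0 \<in> C" and min: "\<And>e. e \<in> C \<Longrightarrow> F e0 \<le> F e"
    by blast
  define h where "h i = v i - A e0 i" for i
  define k where "k i = w i - B e0 i" for i
  have "\<exists>e. e \<in> C \<and>
      (\<Sum>i<m. h i * v i + k i * w i) \<le> (\<Sum>i<m. h i * A e i + k i * B e i)"
    using dual[of h k] unfolding C_iff A_def B_def conj_assoc .
  then obtain e where e: "e \<in> C"
    and le: "(\<Sum>i<m. h i * v i + k i * w i) \<le> (\<Sum>i<m. h i * A e i + k i * B e i)"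
    by blast
  have e_bounds: "0 \<le> e x" "e x \<le> 1" "0 \<le> e0 x" "e0 x \<le> 1"
    and e_sums: "j < n \<Longrightarrow> (\<Sum>i<m. e (i, j)) = 1" "j < n \<Longrightarrow> (\<Sum>i<m. e0 (i, j)) = 1" for x j
    using e e0 unfolding C_iff by blast+
  define L where "L = (\<Sum>i<m. h i * (A e i - A e0 i) + k i * (B e i - B e0 i))"
  define Q where "Q = (\<Sum>i<m. (A e i - A e0 i)\<^sup>2 + (B e i - B e0 i)\<^sup>2)"
  have "L \<le> 0"
  proof (rule nonpos_if_le_quadratic)
    fix t :: real assume t: "0 < t" "t \<le> 1"
    \<comment> \<open>\<open>C\<close> is convex, so the segment from \<open>e0\<close> to
      \<open>e\<close> stays in it, and \<open>F\<close> is quadratic along that segment.\<close>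
    define et where "et x = (1 - t) * e0 x + t * e x" for x
    have A: "A et i = A e0 i + t * (A e i - A e0 i)" and B: "B et i = B e0 i + t * (B e i - B e0 i)"
      for i
      unfolding A_def B_def et_def sum_subtractf[symmetric] sum_distrib_left sum.distrib[symmetric]
      by (auto intro!: sum.cong simp: algebra_simps)
    have "et x \<le> 1" for x
      unfolding et_def using e_bounds t by (intro convex_bound_le) auto
    moreover have "0 \<le> et x" for x
      unfolding et_def using e_bounds t by (intro add_nonneg_nonneg mult_nonneg_nonneg) auto
    moreover have "(\<Sum>i<m. et (i, j)) = 1" if "j < n" for j
      using e_sums[OF that] by (simp add: et_def sum.distrib flip: sum_distrib_left)
    ultimately have "et \<in> C" unfolding C_iff by blast
    then have "F e0 \<le> F et" by (rule min)
    also have "F et = F e0 - 2 * (t * L) + t\<^sup>2 * Q"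
      unfolding F_def L_def Q_def A B h_def k_def sum_distrib_left sum_subtractf[symmetric]
        sum.distrib[symmetric]
      by (rule sum.cong) (simp_all add: power2_eq_square algebra_simps)
    finally show "2 * (t * L) \<le> t\<^sup>2 * Q" by simp
  qed
  moreover have "F e0 = (\<Sum>i<m. h i * v i + k i * w i) - (\<Sum>i<m. h i * A e i + k i * B e i) + L"
    unfolding F_def L_def h_def k_def sum_subtractf[symmetric] sum.distrib[symmetric]
    by (rule sum.cong) (simp_all add: power2_eq_square algebra_simps)
  ultimately have "F e0 \<le> 0" using le by linarith
  moreover have "0 \<le> F e0" unfolding F_def by (intro sum_nonneg) simp
  ultimately have "F e0 = 0" by simp
  then have "\<forall>i<m. (v i - A e0 i)\<^sup>2 + (w i - B e0 i)\<^sup>2 = 0"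
    unfolding F_def by (subst (asm) sum_nonneg_eq_0_iff) auto
  then have "\<forall>i<m. A e0 i = v i \<and> B e0 i = w i" by (simp add: sum_power2_eq_zero_iff)
  then show ?thesis using e0 unfolding C_iff A_def B_def by (intro exI[of _ e0]) simp
qed

text \<open>A functional \<open>(h, k)\<close> splits over the columns, so a deterministic matrix
  maximises it: column \<open>j\<close> puts all its mass in a row where
  \<open>h i * r + k i\<close> is largest at \<open>r = p j / q j\<close>. Convexity of \<phi> is
  encoded by a subgradient \<open>g\<close> at every point, here the slope of the selected affine
  piece.\<close>

lemma stochastic_solution_if_subgradient:
  fixes p q v w :: "nat \<Rightarrow> real"
  assumes m: "m > 0" and q: "\<And>j. j < n \<Longrightarrow> q j > 0" and w: "\<And>i. i < m \<Longrightarrow> w i > 0"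
    and conv: "\<And>\<phi> g. (\<And>s t. \<phi> s + g s * (t - s) \<le> \<phi> t) \<Longrightarrow>
      (\<Sum>i<m. w i * \<phi> (v i / w i)) \<le> (\<Sum>j<n. q j * \<phi> (p j / q j))"
  shows "\<exists>e. (\<forall>x. 0 \<le> e x \<and> e x \<le> 1) \<and> (\<forall>j<n. (\<Sum>i<m. e (i, j)) = 1) \<and>
      (\<forall>i<m. (\<Sum>j<n. e (i, j) * p j) = v i \<and> (\<Sum>j<n. e (i, j) * q j) = w i)"
proof (rule stochastic_solution)
  fix h k :: "nat \<Rightarrow> real"
  have "\<forall>r. \<exists>i. i < m \<and> (\<forall>i'<m. h i' * r + k i' \<le> h i * r + k i)"
  proof
    fix r
    let ?M = "(\<lambda>i. h i * r + k i) ` {..<m}"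
    have M: "finite ?M" "?M \<noteq> {}" using m by auto
    from Max_in[OF this] obtain i where "i < m" "Max ?M = h i * r + k i" by blast
    moreover have "h i' * r + k i' \<le> Max ?M" if "i' < m" for i' using M that by simp
    ultimately show "\<exists>i. i < m \<and> (\<forall>i'<m. h i' * r + k i' \<le> h i * r + k i)" by metis
  qed
  from choice[OF this] obtain \<sigma> where \<sigma>: "\<And>r. \<sigma> r < m"
      "\<And>r i. i < m \<Longrightarrow> h i * r + k i \<le> h (\<sigma> r) * r + k (\<sigma> r)"
    by blast
  define \<phi> where "\<phi> r = h (\<sigma> r) * r + k (\<sigma> r)" for r
  define e :: "nat \<times> nat \<Rightarrow> real"
    where "e x = (if fst x = \<sigma> (p (snd x) / q (snd x)) then 1 else 0)" for x
  have "(\<Sum>i<m. h i * v i + k i * w i) \<le> (\<Sum>i<m. w i * \<phi> (v i / w i))"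
  proof (rule sum_mono)
    fix i assume i: "i \<in> {..<m}"
    then have "w i * (h i * (v i / w i) + k i) \<le> w i * \<phi> (v i / w i)"
      unfolding \<phi>_def using \<sigma>(2)[of i "v i / w i"] w[of i] by (intro mult_left_mono) auto
    then show "h i * v i + k i * w i \<le> w i * \<phi> (v i / w i)"
      using w[of i] i by (simp add: field_simps)
  qed
  also have "\<dots> \<le> (\<Sum>j<n. q j * \<phi> (p j / q j))"
  proof (rule conv)
    show "\<phi> s + h (\<sigma> s) * (t - s) \<le> \<phi> t" for s t
      using \<sigma>(2)[OF \<sigma>(1)[of s], of t] by (simp add: \<phi>_def algebra_simps)
  qed
  also have "\<dots> = (\<Sum>j<n. \<Sum>i<m. e (i, j) * (h i * p j + k i * q j))"
  proof (rule sum.cong)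
    fix j assume j: "j \<in> {..<n}"
    have "(\<Sum>i<m. e (i, j) * (h i * p j + k i * q j))
        = (\<Sum>i<m. if i = \<sigma> (p j / q j) then h i * p j + k i * q j else 0)"
      by (rule sum.cong) (simp_all add: e_def)
    also have "\<dots> = q j * \<phi> (p j / q j)"
      using \<sigma>(1) q[of j] j by (simp add: \<phi>_def field_simps)
    finally show "q j * \<phi> (p j / q j) = (\<Sum>i<m. e (i, j) * (h i * p j + k i * q j))" ..
  qed simp
  also have "\<dots> = (\<Sum>i<m. h i * (\<Sum>j<n. e (i, j) * p j) + k i * (\<Sum>j<n. e (i, j) * q j))"
    by (subst sum.swap) (simp add: sum_distrib_left sum.distrib algebra_simps)
  finally have "(\<Sum>i<m. h i * v i + k i * w i)
      \<le> (\<Sum>i<m. h i * (\<Sum>j<n. e (i, j) * p j) + k i * (\<Sum>j<n. e (i, j) * q j))" .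
  moreover have "\<forall>j<n. (\<Sum>i<m. e (i, j)) = 1" using \<sigma>(1) by (simp add: e_def)
  ultimately show "\<exists>e. (\<forall>x. 0 \<le> e x \<and> e x \<le> 1) \<and> (\<forall>j<n. (\<Sum>i<m. e (i, j)) = 1) \<and>
      (\<Sum>i<m. h i * v i + k i * w i)
        \<le> (\<Sum>i<m. h i * (\<Sum>j<n. e (i, j) * p j) + k i * (\<Sum>j<n. e (i, j) * q j))"
    by (intro exI[of _ e]) (auto simp: e_def)
qed

section \<open>Clipping and its minimality for convex functionals\<close>

text \<open>The excess over \<open>a * q\<close> is removed and the deficit under
  \<open>b * q\<close> is filled; as \<open>b \<le> a\<close>, at most one of them is nonzero. In
  this form the threshold equations give the mass moved by clipping.\<close>

lemma clip_eq:
  fixes a b p q :: real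
  assumes "b \<le> a" "q > 0"
  shows "q * max b (min a (p / q)) = p - max (p - a * q) 0 + max (b * q - p) 0"
proof -
  have *: "b * q \<le> a * q" using assms by simp
  consider "p < b * q" | "b * q \<le> p" "p \<le> a * q" | "a * q < p" by linarith
  then show ?thesis
  proof cases
    case 1
    then have "p / q < b" using assms by (simp add: pos_divide_less_eq)
    moreover have "p < a * q" using 1 * by linarith
    ultimately show ?thesis using 1 assms by (simp add: max_def min_def algebra_simps)
  next
    case 2
    then have "b \<le> p / q" "p / q \<le> a"
      using assms by (simp_all add: pos_divide_le_eq pos_le_divide_eq)
    then show ?thesis using 2 assms by simp
  next
    case 3
    then have "a < p / q" using assms by (simp add: pos_less_divide_eq)
    moreover have "b * q < p" using 3 * by linarith
    ultimately show ?thesis using 3 assms by (simp add: max_def min_def algebra_simps)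
  qed
qed

text \<open>Passing from \<open>p\<close> to \<open>v\<close> lowers the linearised functional by
  exactly \<open>(g a - g b) * \<epsilon>\<close>: all removed mass sits at slope
  \<open>g a\<close>, all added mass at slope \<open>g b\<close>. No competitor gains more, since it
  moves at most mass \<epsilon> and all slopes lie between \<open>g b\<close> and
  \<open>g a\<close>.\<close>

lemma clip_minimises_convex:
  fixes p q p' :: "nat \<Rightarrow> real" and a b \<epsilon> :: real and \<phi> g :: "real \<Rightarrow> real"
  defines "v \<equiv> \<lambda>x. q x * max b (min a (p x / q x))"
  assumes subgradient: "\<And>s t. \<phi> s + g s * (t - s) \<le> \<phi> t"
    and q: "\<And>x. x < d \<Longrightarrow> q x > 0" and ba: "b \<le> a"
    and a: "(\<Sum>x<d. max (p x - a * q x) 0) = \<epsilon>"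
    and b: "(\<Sum>x<d. max (b * q x - p x) 0) = \<epsilon>"
    and mass: "(\<Sum>x<d. p' x) = (\<Sum>x<d. p x)"
    and near: "(\<Sum>x<d. \<bar>p' x - p x\<bar>) \<le> 2 * \<epsilon>"
  shows "(\<Sum>x<d. q x * \<phi> (v x / q x)) \<le> (\<Sum>x<d. q x * \<phi> (p' x / q x))"
proof -
  have mono: "g s \<le> g t" if "s \<le> t" for s t
  proof (cases "s = t")
    case False
    \<comment> \<open>Adding the subgradient inequalities at \<open>s\<close> and at
      \<open>t\<close> cancels \<phi>.\<close>
    have "(g s - g t) * (t - s) \<le> 0"
      using subgradient[of s t] subgradient[of t s] by (simp add: algebra_simps)
    then show ?thesis using False that by (simp add: mult_le_0_iff)
  qed simp
  define G where "G x = g (v x / q x)" for x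
  have ratio: "v x / q x = max b (min a (p x / q x))" if "x < d" for x
    using q[OF that] by (simp add: v_def)
  have G: "g b \<le> G x" "G x \<le> g a" if "x < d" for x
    unfolding G_def ratio[OF that] using ba by (auto intro!: mono)
  \<comment> \<open>Where \<open>p x\<close> exceeds \<open>a * q x\<close>, the clipped ratio is
    \<open>a\<close>; elsewhere both sides vanish. The next fact is the same at
    \<open>b\<close>.\<close>
  have up: "G x * max (p x - a * q x) 0 = g a * max (p x - a * q x) 0" if "x < d" for x
  proof (cases "p x \<le> a * q x")
    case False
    then have "min a (p x / q x) = a" using q[OF that] by (simp add: field_simps)
    then show ?thesis using ba by (simp add: G_def ratio[OF that] max_absorb2)
  qed simp
  have down: "G x * max (b * q x - p x) 0 = g b * max (b * q x - p x) 0" if "x < d" for x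
  proof (cases "b * q x \<le> p x")
    case False
    then have "p x / q x < b" using q[OF that] by (simp add: field_simps)
    then show ?thesis using ba by (simp add: G_def ratio[OF that] max_absorb1 min_le_iff_disj)
  qed simp
  have "(\<Sum>x<d. G x * (p x - v x))
      = (\<Sum>x<d. g a * max (p x - a * q x) 0 - g b * max (b * q x - p x) 0)"
  proof (rule sum.cong)
    fix x assume "x \<in> {..<d}"
    then have x: "x < d" by simp
    have "p x - v x = max (p x - a * q x) 0 - max (b * q x - p x) 0"
      using clip_eq[OF ba q[OF x], of "p x"] by (simp add: v_def)
    then show "G x * (p x - v x) = g a * max (p x - a * q x) 0 - g b * max (b * q x - p x) 0"
      using up[OF x] down[OF x] by (simp only: right_diff_distrib)
  qed simp
  also have "\<dots> = (g a - g b) * \<epsilon>"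
    by (simp add: sum_subtractf a b left_diff_distrib flip: sum_distrib_left)
  finally have gain: "(\<Sum>x<d. G x * (p x - v x)) = (g a - g b) * \<epsilon>" .
  \<comment> \<open>As \<open>p' - p\<close> has total mass zero, \<open>G\<close> may be centred at the midpoint of its range.\<close>
  define c where "c = (g a + g b) / 2"
  have "(\<Sum>x<d. G x * (p x - p' x)) = (\<Sum>x<d. (G x - c) * (p x - p' x))"
    using mass by (simp add: left_diff_distrib sum_subtractf flip: sum_distrib_left)
  also have "\<dots> \<le> (\<Sum>x<d. (g a - g b) / 2 * \<bar>p' x - p x\<bar>)"
  proof (rule sum_mono)
    fix x assume x: "x \<in> {..<d}"
    have "(G x - c) * (p x - p' x) \<le> \<bar>G x - c\<bar> * \<bar>p' x - p x\<bar>"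
      by (metis abs_ge_self abs_minus_commute abs_mult)
    also have "\<dots> \<le> (g a - g b) / 2 * \<bar>p' x - p x\<bar>"
      using G[of x] x by (intro mult_right_mono) (auto simp: c_def abs_le_iff field_simps)
    finally show "(G x - c) * (p x - p' x) \<le> (g a - g b) / 2 * \<bar>p' x - p x\<bar>" .
  qed
  also have "\<dots> \<le> (g a - g b) / 2 * (2 * \<epsilon>)"
    unfolding sum_distrib_left[symmetric] using near mono[OF ba] by (intro mult_left_mono) auto
  finally have "(\<Sum>x<d. G x * (p x - p' x)) \<le> (\<Sum>x<d. G x * (p x - v x))"
    using gain by simp
  then have "0 \<le> (\<Sum>x<d. G x * (p' x - v x))"
    by (simp add: right_diff_distrib sum_subtractf)
  \<comment> \<open>Back from the linear functional to \<phi>: the added term is the subgradient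
    increment at \<open>v x / q x\<close>, scaled by \<open>q x\<close>.\<close>
  then have "(\<Sum>x<d. q x * \<phi> (v x / q x)) \<le> (\<Sum>x<d. q x * \<phi> (v x / q x) + G x * (p' x - v x))"
    by (simp add: sum.distrib)
  also have "\<dots> \<le> (\<Sum>x<d. q x * \<phi> (p' x / q x))"
  proof (rule sum_mono)
    fix x assume "x \<in> {..<d}"
    then have x: "q x > 0" using q by simp
    have "q x * \<phi> (v x / q x) + G x * (p' x - v x)
        = q x * (\<phi> (v x / q x) + G x * (p' x / q x - v x / q x))"
      using x by (simp add: distrib_left right_diff_distrib mult.left_commute)
    also have "\<dots> \<le> q x * \<phi> (p' x / q x)"
      unfolding G_def using x by (intro mult_left_mono subgradient) auto
    finally show "q x * \<phi> (v x / q x) + G x * (p' x - v x) \<le> q x * \<phi> (p' x / q x)" .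
  qed
  finally show ?thesis .
qed

section \<open>The thresholds solve their mass equations\<close>

text \<open>The excess mass \<open>F\<close> is continuous and nonincreasing, at least \<epsilon> at
  1 and zero far out, so it takes the value \<epsilon>. Below 1 it is strictly larger than at 1, so
  the infimum ranges over a closed subset of \<open>{t. 1 \<le> t}\<close> and is attained.\<close>

lemma upper_threshold_props:
  assumes p: "p \<in> Prob d" and q: "q \<in> Prob d" and qpos: "\<forall>x<d. q $ x > 0"
    and \<epsilon>: "0 \<le> \<epsilon>" "\<epsilon> \<le> (\<Sum>x<d. max (p $ x - q $ x) 0)"
  shows "1 \<le> upper_threshold \<epsilon> p q"
    and "(\<Sum>x<d. max (p $ x - upper_threshold \<epsilon> p q * q $ x) 0) = \<epsilon>"
proof -
  define F where "F t = (\<Sum>x<d. max (p $ x - t * q $ x) 0)" for t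
  define S where "S = {t. t > 0 \<and> F t \<le> \<epsilon>}"
  have p0: "\<And>x. x < d \<Longrightarrow> 0 \<le> p $ x"
    and p1: "(\<Sum>x<d. p $ x) = 1" and q1: "(\<Sum>x<d. q $ x) = 1"
    and dim: "dim_vec p = d"
    using p q by (auto simp: Prob_def)
  have thr: "upper_threshold \<epsilon> p q = Inf S"
    by (simp add: upper_threshold_def S_def F_def dim)
  have cont: "continuous_on X F" for X unfolding F_def by (intro continuous_intros)
  have anti: "F t \<le> F s" if "s \<le> t" for s t
    unfolding F_def using that qpos
    by (intro sum_mono max.mono diff_mono mult_right_mono) (auto simp: less_imp_le)
  \<comment> \<open>Strictness matters when \<open>\<epsilon> = F 1\<close>. If no entry of
    \<open>p\<close> exceeds that of \<open>q\<close>, then \<open>F 1 = 0\<close>, and comparing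
    total masses gives \<open>F t \<ge> 1 - t\<close>.\<close>
  have strict: "F 1 < F t" if t: "t < 1" for t
  proof (cases "\<exists>x<d. q $ x < p $ x")
    case True
    then obtain x where x: "x < d" "q $ x < p $ x" by blast
    have less: "t * q $ y < q $ y" if "y < d" for y using qpos t that by simp
    show ?thesis unfolding F_def
    proof (rule sum_strict_mono_ex1)
      show "\<forall>y\<in>{..<d}. max (p $ y - 1 * q $ y) 0 \<le> max (p $ y - t * q $ y) 0"
        using less by (force simp: max_def)
      show "\<exists>y\<in>{..<d}. max (p $ y - 1 * q $ y) 0 < max (p $ y - t * q $ y) 0"
        using x less[of x] by (intro bexI[of _ x]) (auto simp: max_def)
    qed simp
  next
    case False
    then have "\<forall>x<d. p $ x \<le> q $ x" by (meson not_less)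
    then have "F 1 = 0" unfolding F_def by (intro sum.neutral) auto
    also have "0 < (\<Sum>x<d. p $ x - t * q $ x)"
      using t by (simp add: sum_subtractf p1 q1 flip: sum_distrib_left)
    also have "\<dots> \<le> F t" unfolding F_def by (intro sum_mono) simp
    finally show ?thesis .
  qed
  have F1: "\<epsilon> \<le> F 1" using \<epsilon>(2) by (simp add: F_def)
  have ge1: "1 \<le> t" if "t \<in> S" for t
    using strict[of t] that F1 by (force simp: S_def)
  \<comment> \<open>This is at least 1 and at least every ratio, so \<open>F\<close> vanishes at
    \<open>T\<close> and the intermediate value theorem applies on \<open>[1, T]\<close>.\<close>
  define T where "T = 1 + (\<Sum>x<d. p $ x / q $ x)"
  have "0 \<le> (\<Sum>x<d. p $ x / q $ x)" using p0 qpos by (intro sum_nonneg) (simp add: less_imp_le)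
  then have T1: "1 \<le> T" by (simp add: T_def)
  have "p $ x \<le> T * q $ x" if "x < d" for x
  proof -
    have "p $ x / q $ x \<le> (\<Sum>x<d. p $ x / q $ x)"
      using that p0 qpos by (intro member_le_sum) (auto simp: less_imp_le)
    then have "p $ x / q $ x \<le> T" by (simp add: T_def)
    then show ?thesis using qpos that by (simp add: field_simps)
  qed
  then have "F T = 0" unfolding F_def by (intro sum.neutral) (auto simp: max_def)
  then obtain c where c: "1 \<le> c" "F c = \<epsilon>"
    using IVT2'[of F T \<epsilon> 1] \<epsilon>(1) F1 T1 cont by auto
  then have cS: "c \<in> S" by (simp add: S_def)
  have bdd: "bdd_below S" using ge1 by (rule bdd_belowI)
  have "S = {t. 1 \<le> t} \<inter> {t. F t \<le> \<epsilon>}" using ge1 by (auto simp: S_def)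
  moreover have "closed ({t. 1 \<le> t} \<inter> {t. F t \<le> \<epsilon>})"
    by (intro closed_Int closed_Collect_le cont continuous_intros)
  ultimately have "Inf S \<in> S"
    using closed_contains_Inf[of S] cS bdd by auto
  then show "1 \<le> upper_threshold \<epsilon> p q" using ge1 thr by simp
  have "\<epsilon> \<le> F (Inf S)" using anti[OF cInf_lower[OF cS bdd]] c by simp
  then have "F (Inf S) = \<epsilon>" using \<open>Inf S \<in> S\<close> by (simp add: S_def)
  then show "(\<Sum>x<d. max (p $ x - upper_threshold \<epsilon> p q * q $ x) 0) = \<epsilon>"
    unfolding thr F_def .
qed

text \<open>The mirror image, with nondecreasing deficit mass. As \<open>F 0 = 0\<close>, the
  inserted 0 satisfies the defining inequality, so the set is closed and nonempty even when no
  positive \<open>t\<close> qualifies.\<close>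

lemma lower_threshold_props:
  assumes p: "p \<in> Prob d" and q: "q \<in> Prob d" and qpos: "\<forall>x<d. q $ x > 0"
    and \<epsilon>: "0 \<le> \<epsilon>" "\<epsilon> \<le> (\<Sum>x<d. max (q $ x - p $ x) 0)"
  shows "0 \<le> lower_threshold \<epsilon> p q" and "lower_threshold \<epsilon> p q \<le> 1"
    and "(\<Sum>x<d. max (lower_threshold \<epsilon> p q * q $ x - p $ x) 0) = \<epsilon>"
proof -
  define F where "F t = (\<Sum>x<d. max (t * q $ x - p $ x) 0)" for t
  define S where "S = insert 0 {t. t > 0 \<and> F t \<le> \<epsilon>}"
  have p0: "\<And>x. x < d \<Longrightarrow> 0 \<le> p $ x"
    and p1: "(\<Sum>x<d. p $ x) = 1" and q1: "(\<Sum>x<d. q $ x) = 1"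
    and dim: "dim_vec p = d"
    using p q by (auto simp: Prob_def)
  have thr: "lower_threshold \<epsilon> p q = Sup S"
    by (simp add: lower_threshold_def S_def F_def dim)
  have cont: "continuous_on X F" for X unfolding F_def by (intro continuous_intros)
  have mono: "F s \<le> F t" if "s \<le> t" for s t
    unfolding F_def using that qpos
    by (intro sum_mono max.mono diff_mono mult_right_mono) (auto simp: less_imp_le)
  have strict: "F 1 < F t" if t: "1 < t" for t
  proof (cases "\<exists>x<d. p $ x < q $ x")
    case True
    then obtain x where x: "x < d" "p $ x < q $ x" by blast
    have less: "q $ y < t * q $ y" if "y < d" for y using qpos t that by simp
    show ?thesis unfolding F_def
    proof (rule sum_strict_mono_ex1)
      show "\<forall>y\<in>{..<d}. max (1 * q $ y - p $ y) 0 \<le> max (t * q $ y - p $ y) 0"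
        using less by (force simp: max_def)
      show "\<exists>y\<in>{..<d}. max (1 * q $ y - p $ y) 0 < max (t * q $ y - p $ y) 0"
        using x less[of x] by (intro bexI[of _ x]) (auto simp: max_def)
    qed simp
  next
    case False
    then have "\<forall>x<d. q $ x \<le> p $ x" by (meson not_less)
    then have "F 1 = 0" unfolding F_def by (intro sum.neutral) auto
    also have "0 < (\<Sum>x<d. t * q $ x - p $ x)"
      using t by (simp add: sum_subtractf p1 q1 flip: sum_distrib_left)
    also have "\<dots> \<le> F t" unfolding F_def by (intro sum_mono) simp
    finally show ?thesis .
  qed
  have F0: "F 0 = 0" unfolding F_def using p0 by (intro sum.neutral) (auto simp: max_def)
  have F1: "\<epsilon> \<le> F 1" using \<epsilon>(2) by (simp add: F_def)
  have le1: "t \<le> 1" if "t \<in> S" for t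
    using strict[of t] that F1 by (force simp: S_def)
  obtain c where c: "0 \<le> c" "F c = \<epsilon>"
    using IVT'[of F 0 \<epsilon> 1] \<epsilon>(1) F0 F1 cont by auto
  then have cS: "c \<in> S" by (auto simp: S_def less_le)
  have bdd: "bdd_above S" using le1 by (rule bdd_aboveI)
  have "S = {t. 0 \<le> t} \<inter> {t. F t \<le> \<epsilon>}" using F0 \<epsilon>(1) by (auto simp: S_def less_le)
  moreover have "closed ({t. 0 \<le> t} \<inter> {t. F t \<le> \<epsilon>})"
    by (intro closed_Int closed_Collect_le cont continuous_intros)
  ultimately have S: "Sup S \<in> S" "0 \<le> Sup S" "F (Sup S) \<le> \<epsilon>"
    using closed_contains_Sup[of S] cS bdd by auto
  then show "0 \<le> lower_threshold \<epsilon> p q" "lower_threshold \<epsilon> p q \<le> 1"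
    using le1 thr by simp_all
  have "\<epsilon> \<le> F (Sup S)" using mono[OF cSup_upper[OF cS bdd]] c by simp
  then have "F (Sup S) = \<epsilon>" using S by simp
  then show "(\<Sum>x<d. max (lower_threshold \<epsilon> p q * q $ x - p $ x) 0) = \<epsilon>"
    unfolding thr F_def .
qed

section \<open>Total variation and flattest approximations\<close>

lemma l1_norm_diff:
  assumes "p \<in> carrier_vec d" "q \<in> carrier_vec d"
  shows "l1_norm (p - q) = (\<Sum>x<d. \<bar>p $ x - q $ x\<bar>)"
proof -
  have dims: "dim_vec (p - q) = d" "dim_vec q = d" using assms by simp_all
  then have "(p - q) $ x = p $ x - q $ x" if "x < d" for x using that by simp
  then show ?thesis unfolding l1_norm_def dims by (intro sum.cong) simp_all
qed

text \<open>\<open>p - q\<close> has total mass zero, so its positive and negative parts have equal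
  mass. These are the excess and deficit masses at parameter 1 that bound \<epsilon> in the two
  threshold lemmas.\<close>

lemma total_variation_eq:
  assumes p: "p \<in> Prob d" and q: "q \<in> Prob d"
  shows "1/2 * l1_norm (p - q) = (\<Sum>x<d. max (p $ x - q $ x) 0)"
    and "1/2 * l1_norm (p - q) = (\<Sum>x<d. max (q $ x - p $ x) 0)"
proof -
  have mass: "(\<Sum>x<d. p $ x) = 1" "(\<Sum>x<d. q $ x) = 1"
    and dims: "p \<in> carrier_vec d" "q \<in> carrier_vec d"
    using p q by (auto simp: Prob_def)
  have "(\<Sum>x<d. \<bar>p $ x - q $ x\<bar>) = (\<Sum>x<d. 2 * max (p $ x - q $ x) 0 - (p $ x - q $ x))"
    by (rule sum.cong) (auto simp: max_def)
  also have "\<dots> = 2 * (\<Sum>x<d. max (p $ x - q $ x) 0)"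
    by (simp add: sum_subtractf mass sum_distrib_left)
  finally show "1/2 * l1_norm (p - q) = (\<Sum>x<d. max (p $ x - q $ x) 0)"
    by (simp add: l1_norm_diff[OF dims])
  have "(\<Sum>x<d. \<bar>p $ x - q $ x\<bar>) = (\<Sum>x<d. 2 * max (q $ x - p $ x) 0 + (p $ x - q $ x))"
    by (rule sum.cong) (auto simp: max_def)
  also have "\<dots> = 2 * (\<Sum>x<d. max (q $ x - p $ x) 0)"
    by (simp add: sum_subtractf sum.distrib mass sum_distrib_left)
  finally show "1/2 * l1_norm (p - q) = (\<Sum>x<d. max (q $ x - p $ x) 0)"
    by (simp add: l1_norm_diff[OF dims])
qed

lemma rel_majorizesI:
  fixes p q v w :: "real vec"
  assumes dims: "p \<in> carrier_vec n" "q \<in> carrier_vec n" "v \<in> carrier_vec m" "w \<in> carrier_vec m"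
    and e: "\<forall>x. 0 \<le> e x" "\<forall>j<n. (\<Sum>i<m. e (i, j)) = 1"
      "\<forall>i<m. (\<Sum>j<n. e (i, j) * p $ j) = v $ i \<and> (\<Sum>j<n. e (i, j) * q $ j) = w $ i"
  shows "(p, q) \<succ> (v, w)"
proof -
  have "column_stochastic (mat m n e)" using e by (simp add: column_stochastic_def)
  moreover have "mat m n e *\<^sub>v p = v" "mat m n e *\<^sub>v q = w"
    using dims e by (auto simp: scalar_prod_def lessThan_atLeast0 intro!: eq_vecI)
  ultimately show ?thesis
    using dims unfolding rel_majorizes_def by (intro bexI[of _ "mat m n e"]) auto
qed

text \<open>The bound on \<epsilon> gives \<open>b \<le> 1 \<le> a\<close>, and clipping removes and
  adds mass \<epsilon> each. The total mass is therefore kept and the l1 distance is at most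
  \<open>2 * \<epsilon>\<close>.\<close>

lemma flattest_approx_clipped_vec:
  assumes p: "p \<in> Prob d" and q: "q \<in> Prob d" and qpos: "\<forall>x<d. q $ x > 0"
    and \<epsilon>: "0 \<le> \<epsilon>" "\<epsilon> \<le> 1/2 * l1_norm (p - q)"
  shows "flattest_approx \<epsilon> p q (clipped_vec \<epsilon> p q)"
proof -
  define a where "a = upper_threshold \<epsilon> p q"
  define b where "b = lower_threshold \<epsilon> p q"
  define v where "v = clipped_vec \<epsilon> p q"
  have p0: "\<And>x. x < d \<Longrightarrow> 0 \<le> p $ x"
    and p1: "(\<Sum>x<d. p $ x) = 1" and q1: "(\<Sum>x<d. q $ x) = 1"
    and dims: "p \<in> carrier_vec d" "q \<in> carrier_vec d" "dim_vec p = d"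
    using p q by (auto simp: Prob_def)
  have a: "1 \<le> a" "(\<Sum>x<d. max (p $ x - a * q $ x) 0) = \<epsilon>"
    using upper_threshold_props[OF p q qpos \<epsilon>(1)] \<epsilon>(2) total_variation_eq(1)[OF p q]
    by (auto simp: a_def)
  have b: "0 \<le> b" "b \<le> 1" "(\<Sum>x<d. max (b * q $ x - p $ x) 0) = \<epsilon>"
    using lower_threshold_props[OF p q qpos \<epsilon>(1)] \<epsilon>(2) total_variation_eq(2)[OF p q]
    by (auto simp: b_def)
  have ba: "b \<le> a" using a b by simp
  have v: "v $ x = q $ x * max b (min a (p $ x / q $ x))" if "x < d" for x
    using that by (simp add: v_def clipped_vec_def dims a_def b_def)
  have v': "v $ x = p $ x - max (p $ x - a * q $ x) 0 + max (b * q $ x - p $ x) 0"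
    if "x < d" for x
    using v[OF that] clip_eq[OF ba] qpos that by simp
  have dv: "v \<in> carrier_vec d" by (simp add: v_def clipped_vec_def dims(3))
  have "0 \<le> v $ x" if "x < d" for x
    using that b qpos unfolding v[OF that] by (intro mult_nonneg_nonneg) (auto simp: less_imp_le)
  moreover have "(\<Sum>x<d. v $ x) = 1"
    by (simp add: v' sum.distrib sum_subtractf a b p1)
  ultimately have vP: "v \<in> Prob d" using dv by (simp add: Prob_def)
  have "(\<Sum>x<d. \<bar>p $ x - v $ x\<bar>)
      \<le> (\<Sum>x<d. max (p $ x - a * q $ x) 0 + max (b * q $ x - p $ x) 0)"
    by (rule sum_mono) (auto simp: v')
  then have "1/2 * l1_norm (p - v) \<le> \<epsilon>"
    unfolding l1_norm_diff[OF dims(1) dv] sum.distrib a b by simp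
  then have ball: "v \<in> prob_ball \<epsilon> p" using vP by (simp add: prob_ball_def dims)
  have "(p', q) \<succ> (v, q)" if p': "p' \<in> prob_ball \<epsilon> p" for p'
  proof -
    have p'P: "p' \<in> Prob d" and norm: "l1_norm (p - p') \<le> 2 * \<epsilon>"
      using p' by (auto simp: prob_ball_def dims)
    have mass: "(\<Sum>x<d. p' $ x) = (\<Sum>x<d. p $ x)" and dp': "p' \<in> carrier_vec d"
      using p'P p1 by (auto simp: Prob_def)
    have near: "(\<Sum>x<d. \<bar>p' $ x - p $ x\<bar>) \<le> 2 * \<epsilon>"
      using norm by (simp add: l1_norm_diff[OF dims(1) dp'] abs_minus_commute)
    \<comment> \<open>Ensures that there is a row to select as maximiser.\<close>
    have "d > 0" using p1 by (cases d) auto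
    then have "\<exists>e. (\<forall>x. 0 \<le> e x \<and> e x \<le> 1) \<and> (\<forall>j<d. (\<Sum>i<d. e (i, j)) = 1) \<and>
      (\<forall>i<d. (\<Sum>j<d. e (i, j) * p' $ j) = v $ i \<and> (\<Sum>j<d. e (i, j) * q $ j) = q $ i)"
    proof (rule stochastic_solution_if_subgradient)
      fix \<phi> g :: "real \<Rightarrow> real"
      assume "\<And>s t. \<phi> s + g s * (t - s) \<le> \<phi> t"
      then have "(\<Sum>x<d. q $ x * \<phi> (q $ x * max b (min a (p $ x / q $ x)) / q $ x))
          \<le> (\<Sum>x<d. q $ x * \<phi> (p' $ x / q $ x))"
        using qpos ba a(2) b(3) mass near by (intro clip_minimises_convex) auto
      then show "(\<Sum>x<d. q $ x * \<phi> (v $ x / q $ x)) \<le> (\<Sum>x<d. q $ x * \<phi> (p' $ x / q $ x))"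
        by (simp add: v)
    qed (use qpos in auto)
    then obtain e where e: "\<forall>x. 0 \<le> e x \<and> e x \<le> 1" "\<forall>j<d. (\<Sum>i<d. e (i, j)) = 1"
        "\<forall>i<d. (\<Sum>j<d. e (i, j) * p' $ j) = v $ i \<and> (\<Sum>j<d. e (i, j) * q $ j) = q $ i"
      by (elim exE conjE)
    show ?thesis
      by (rule rel_majorizesI[OF dp' dims(2) dv dims(2) _ e(2,3)]) (use e(1) in simp)
  qed
  then show ?thesis using ball by (simp add: flattest_approx_def v_def)
qed

text \<open>The ball contains \<open>q\<close>, and the matrix with all columns equal to
  \<open>q\<close> sends every probability vector to \<open>q\<close>.\<close>

lemma flattest_approx_far:
  assumes p: "p \<in> Prob d" and q: "q \<in> Prob d" and \<epsilon>: "1/2 * l1_norm (p - q) \<le> \<epsilon>"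
  shows "flattest_approx \<epsilon> p q q"
proof -
  have q0: "\<And>x. x < d \<Longrightarrow> 0 \<le> q $ x" and q1: "(\<Sum>x<d. q $ x) = 1"
    and dims: "q \<in> carrier_vec d" "dim_vec p = d"
    using p q by (auto simp: Prob_def)
  have "(p', q) \<succ> (q, q)" if "p' \<in> Prob d" for p'
  \<comment> \<open>The value 0 beyond \<open>d\<close> keeps \<open>e\<close> nonnegative at all
    indices, where \<open>q $ i\<close> would be unspecified.\<close>
  proof (rule rel_majorizesI[where e = "\<lambda>(i, j). if i < d then q $ i else 0"])
    show "p' \<in> carrier_vec d" using that by (simp add: Prob_def)
    have "(\<Sum>x<d. p' $ x) = 1" using that by (simp add: Prob_def)
    then show "\<forall>i<d. (\<Sum>j<d. (case (i, j) of (i, j) \<Rightarrow> if i < d then q $ i else 0) * p' $ j) = q $ i \<and>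
        (\<Sum>j<d. (case (i, j) of (i, j) \<Rightarrow> if i < d then q $ i else 0) * q $ j) = q $ i"
      using q1 by (simp flip: sum_distrib_left)
  qed (use dims q0 q1 in auto)
  then show ?thesis using q \<epsilon> by (simp add: flattest_approx_def prob_ball_def dims)
qed

section \<open>Smoothed divergences\<close>

text \<open>Membership of \<open>v\<close> in the ball bounds the infimum above; monotonicity of
  \<open>D\<close> under a matrix that fixes \<open>q\<close> and sends \<open>p'\<close> to
  \<open>v\<close> bounds it below.\<close>

lemma smoothed_divergence_eq:
  assumes D: "classical_divergence D" and flat: "flattest_approx \<epsilon> p q v"
    and p: "p \<in> Prob d" and q: "q \<in> Prob d"
  shows "smoothed_divergence D \<epsilon> p q = D v q"
  unfolding smoothed_divergence_def
proof (rule antisym)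
  show "(INF p'\<in>prob_ball \<epsilon> p. D p' q) \<le> D v q"
    using flat by (intro INF_lower) (simp add: flattest_approx_def)
  show "D v q \<le> (INF p'\<in>prob_ball \<epsilon> p. D p' q)"
  proof (rule INF_greatest)
    fix p' assume p': "p' \<in> prob_ball \<epsilon> p"
    then have P: "p' \<in> Prob d" using p by (auto simp: prob_ball_def Prob_def)
    have "(p', q) \<succ> (v, q)" using flat p' by (simp add: flattest_approx_def)
    then obtain E where "E \<in> carrier_mat (dim_vec v) (dim_vec p')" "column_stochastic E"
      and E: "E *\<^sub>v p' = v" "E *\<^sub>v q = q"
      by (auto simp: rel_majorizes_def)
    moreover have "dim_vec p' = d" using P by (auto simp: Prob_def)
    ultimately have "D (E *\<^sub>v p') (E *\<^sub>v q) \<le> D p' q"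
      using D P q unfolding classical_divergence_def by blast
    then show "D v q \<le> D p' q" by (simp add: E)
  qed
qed

text \<open>The case split reflects \<open>clipped_vec_not_Prob\<close>: beyond the total variation
  distance clipping leaves the probability vectors, and \<open>q\<close> takes over. At equality
  both thresholds are 1 and clipping already yields \<open>q\<close>.\<close>

theorem theorem7:
  fixes d :: nat and \<epsilon> :: real and p q :: "real vec"
  assumes "0 \<le> \<epsilon>" and "\<epsilon> \<le> 1"
    and "p \<in> Prob d" and "q \<in> Prob d"
    and "\<forall>x<d. q $ x > 0"
  shows "(\<epsilon> \<le> 1/2 * l1_norm (p - q) \<longrightarrow>
            flattest_approx \<epsilon> p q (clipped_vec \<epsilon> p q) \<and>
            (\<forall>D. classical_divergence D \<longrightarrow>
               smoothed_divergence D \<epsilon> p q = D (clipped_vec \<epsilon> p q) q)) \<and>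
         (1/2 * l1_norm (p - q) < \<epsilon> \<longrightarrow>
            flattest_approx \<epsilon> p q q \<and>
            (\<forall>D. classical_divergence D \<longrightarrow>
               smoothed_divergence D \<epsilon> p q = D q q))"
proof (intro conjI impI allI)
  assume "\<epsilon> \<le> 1/2 * l1_norm (p - q)"
  then show flat: "flattest_approx \<epsilon> p q (clipped_vec \<epsilon> p q)"
    using flattest_approx_clipped_vec[OF assms(3,4,5,1)] by simp
  show "smoothed_divergence D \<epsilon> p q = D (clipped_vec \<epsilon> p q) q" if "classical_divergence D" for D
    using smoothed_divergence_eq[OF that flat assms(3,4)] .
next
  assume "1/2 * l1_norm (p - q) < \<epsilon>"
  then show flat: "flattest_approx \<epsilon> p q q"
    using flattest_approx_far[OF assms(3,4)] by simp
  show "smoothed_divergence D \<epsilon> p q = D q q" if "classical_divergence D" for D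
    using smoothed_divergence_eq[OF that flat assms(3,4)] .
qed

end
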